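(* Let $\mathbb{K}=\bigcup_{m\ge 1}\mathbb{R}((t^{1/m}))$ and $$F=x^3+y^3-x^2y-xy^2+2x^2+2y^2+4xy-8x-8y+8\in\mathbb{K}[x,y].$$ Then the ideal $(F)\subseteq\mathbb{K}[x,y]$ is real radical and admits no real tropical basis. In particular, there exist real radical ideals that do not admit a real tropical basis.
   Context: $\mathbb{K}$ is the real closed field of real Puiseux series; the valuation $v(x)\in\mathbb{Q}$ of $x\in\mathbb{K}^*$ is the least exponent of $t$ occurring in $x$, and $x>0$ iff the coefficient of its least-exponent term is positive. Put $\mathbb{TR}=\{1,-1\}\times\mathbb{R}$ (with the product topology) and $trop:\mathbb{K}^*\to\mathbb{TR}$, $trop(x)=(s(x),v(x))$ with $s(x)=\pm1$ the sign of $x$; $trop$ is applied component-wise on $(\mathbb{K}^* )^n$. For $a=(\sigma,\alpha)\in\mathbb{TR}$ write $s(a)=\sigma$ and $|a|=\alpha$; for $p\in\mathbb{TR}^n$, $|p|=(|p_1|,\ldots,|p_n|)$. For an ideal $I\subseteq\mathbb{K}[x_1,\ldots,x_n]$, $\mathcal{V}(I)$ is its set of zeros with coordinates in $\mathbb{K}$, and $trop(\mathcal{V}(I))$ denotes the closure in $\mathbb{TR}^n$ of the image under $trop$ of $\mathcal{V}(I)\cap(\mathbb{K}^* )^n$. For a polynomial $F=\sum_{\ell\in A}a_\ell x^\ell$ with support $A$ (all $a_\ell\ne0$), with $A\neq\emptyset$, $\mathcal{T}_{\mathbb{R}}(F)\subseteq\mathbb{TR}^n$ is the set of points $p$ for which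 there are two exponents $i\neq j$ in $A$, both attaining $\min_{\ell\in A}\big(v(a_\ell)+\langle \ell,|p|\rangle\big)$, such that $s(a_i)\prod_{k=1}^n s(p_k)^{i_k}=1$ and $s(a_j)\prod_{k=1}^n s(p_k)^{j_k}=-1$. A real tropical basis of $I$ is a finite set of nonzero polynomials $\{F_1,\ldots,F_r\}$ generating $I$ such that $trop(\mathcal{V}(I))=\bigcap_{i=1}^r\mathcal{T}_{\mathbb{R}}(F_i)$. An ideal $I$ is real radical if $I=\sqrt[\mathbb{R}]{I}$, where $\sqrt[\mathbb{R}]{I}$ is the set of $F$ for which there exist $m>0$ and polynomials $G_1,\ldots,G_r$ with $F^{2m}+\sum_{i=1}^r G_i^2\in I$. *)

theory Defs
  imports
    "HOL-Analysis.Analysis"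
    "HOL-Computational_Algebra.Formal_Laurent_Series"
    "HOL-Library.Poly_Mapping"
begin

no_notation fps_nth (infixl \<open>$\<close> 75)
notation fls_nth (infixl \<open>$$\<close> 75)

section \<open>The field of real Puiseux series\<close>

text \<open>
  A Puiseux series is represented by its coefficient function on the rational exponents.
  The function \<open>laurent_root m f\<close> is the one of \<open>f(t\<^bsup>1/m\<^esup>)\<close>, for a Laurent series \<open>f\<close>; the range
  of \<open>laurent_root m\<close> is therefore \<open>\<real>((t\<^bsup>1/m\<^esup>))\<close>.
\<close>

definition laurent_root :: "nat \<Rightarrow> real fls \<Rightarrow> rat \<Rightarrow> real" where
  "laurent_root m f q = (if of_nat m * q \<in> \<int> then f $$ \<lfloor>of_nat m * q\<rfloor> else 0)"

typedef puiseux = "\<Union>m\<in>{1..}. range (laurent_root m)"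
  morphisms puiseux_coeff Abs_puiseux
  by blast

setup_lifting type_definition_puiseux

lemma puiseux_eqI: "(\<And>q. puiseux_coeff x q = puiseux_coeff y q) \<Longrightarrow> x = y"
  by (simp add: puiseux_coeff_inject[symmetric] fun_eq_iff)

lemma laurent_root_div: "m > 0 \<Longrightarrow> laurent_root m f (of_int k / of_nat m) = f $$ k"
  by (simp add: laurent_root_def)

lemma laurent_root_compose_power:
  assumes "m > 0" "d > 0"
  shows "laurent_root (m * d) (fls_compose_power f d) = laurent_root m f"
proof
  fix q :: rat
  show "laurent_root (m * d) (fls_compose_power f d) q = laurent_root m f q"
  proof (cases "of_nat (m * d) * q \<in> \<int>")
    case True
    then obtain k where k: "of_nat (m * d) * q = of_int k"
      by (auto elim: Ints_cases)
    have mq: "of_nat m * q = of_int k / of_nat d"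
      using k assms by (simp add: field_simps)
    have iff: "of_nat m * q \<in> \<int> \<longleftrightarrow> int d dvd k"
    proof
      assume "of_nat m * q \<in> \<int>"
      then obtain j where "of_nat m * q = of_int j" by (auto elim: Ints_cases)
      then have "(of_int k :: rat) = of_int (int d * j)"
        using mq assms by (simp add: field_simps)
      then have "k = int d * j" using of_int_eq_iff by blast
      then show "int d dvd k" by simp
    next
      assume "int d dvd k"
      then show "of_nat m * q \<in> \<int>" using mq assms by (auto elim!: dvdE)
    qed
    have "\<lfloor>of_nat m * q\<rfloor> = k div int d"
      unfolding mq using floor_divide_of_int_eq[of k "int d", where 'a=rat] by simp
    then show ?thesis
      using k iff assms unfolding laurent_root_def by (simp add: fls_nth_compose_power)
  next
    case False
    have "of_nat m * q \<notin> \<int>"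
    proof
      assume "of_nat m * q \<in> \<int>"
      then have "of_nat d * (of_nat m * q) \<in> \<int>" by (rule Ints_mult[rotated]) simp
      moreover have "of_nat d * (of_nat m * q) = of_nat (m * d) * q"
        by (simp only: of_nat_mult mult_ac)
      ultimately show False using False by metis
    qed
    then have "laurent_root m f q = 0" by (simp add: laurent_root_def)
    moreover have "laurent_root (m * d) (fls_compose_power f d) q = 0"
      using False by (simp only: laurent_root_def if_False)
    ultimately show ?thesis by simp
  qed
qed

lemma laurent_root_common2:
  assumes "f \<in> (\<Union>m\<in>{1..}. range (laurent_root m))" "g \<in> (\<Union>m\<in>{1..}. range (laurent_root m))"
  obtains m F G where "m > 0" "f = laurent_root m F" "g = laurent_root m G"
proof -
  from assms obtain m n F G where *: "m > 0" "n > 0" "f = laurent_root m F" "g = laurent_root n G"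
    by (auto simp: Suc_le_eq)
  show thesis
    by (rule that[of "m * n" "fls_compose_power F n" "fls_compose_power G m"])
       (use * laurent_root_compose_power[of m n F] laurent_root_compose_power[of n m G]
        in \<open>simp_all add: mult.commute\<close>)
qed

lemma laurent_root_mem: "m > 0 \<Longrightarrow> laurent_root m F \<in> (\<Union>m\<in>{1..}. range (laurent_root m))"
  by (auto intro!: bexI[of _ m])

lemma laurent_root_add: "laurent_root m F q + laurent_root m G q = laurent_root m (F + G) q"
  and laurent_root_diff: "laurent_root m F q - laurent_root m G q = laurent_root m (F - G) q"
  and laurent_root_uminus: "- laurent_root m F q = laurent_root m (- F) q"
  by (simp_all add: laurent_root_def)

lemma laurent_root_nonzero:
  assumes "m > 0" "laurent_root m F q \<noteq> 0"
  obtains k where "q = of_int k / of_nat m" "F $$ k \<noteq> 0"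
proof -
  from assms(2) have "of_nat m * q \<in> \<int>" by (auto simp: laurent_root_def split: if_splits)
  then obtain k where "of_nat m * q = of_int k" by (auto elim: Ints_cases)
  then have q: "q = of_int k / of_nat m" using assms(1) by (simp add: field_simps)
  show thesis using that[OF q] assms q by (simp add: laurent_root_div)
qed

lemma laurent_root_mult:
  assumes m: "m > 0"
  shows "(\<Sum>r | laurent_root m F r \<noteq> 0 \<and> laurent_root m G (q - r) \<noteq> 0.
            laurent_root m F r * laurent_root m G (q - r)) = laurent_root m (F * G) q"
    (is "sum ?h ?S = _")
proof (cases "of_nat m * q \<in> \<int>")
  case False
  have "?S = {}"
  proof safe
    fix r assume r: "laurent_root m F r \<noteq> 0" "laurent_root m G (q - r) \<noteq> 0"
    obtain k where k: "r = of_int k / of_nat m" using laurent_root_nonzero[OF m r(1)] by blast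
    obtain l where l: "q - r = of_int l / of_nat m" using laurent_root_nonzero[OF m r(2)] by blast
    have "of_nat m * q = of_int (k + l)" using k l m by (simp add: field_simps)
    then have "of_nat m * q \<in> \<int>" by (metis Ints_of_int)
    then show "r \<in> {}" using False by simp
  qed
  then have "sum ?h ?S = 0" by (simp only: sum.empty)
  then show ?thesis using False by (simp add: laurent_root_def)
next
  case True
  then obtain n where "of_nat m * q = of_int n" by (auto elim: Ints_cases)
  then have q: "q = of_int n / of_nat m" using m by (simp add: field_simps)
  define c where "c = (\<lambda>i::int. of_int i / (of_nat m :: rat))"
  define I where "I = {fls_subdegree F .. n - fls_subdegree G}"
  have inj: "inj_on c I" using m by (auto simp: inj_on_def c_def)
  have qc: "q - c i = c (n - i)" for i by (simp add: q c_def diff_divide_distrib)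
  have Fc: "laurent_root m f (c i) = f $$ i" for f i
    using laurent_root_div[OF m] by (simp add: c_def)
  have sub: "?S \<subseteq> c ` I"
  proof
    fix r assume "r \<in> ?S"
    then have r: "laurent_root m F r \<noteq> 0" "laurent_root m G (q - r) \<noteq> 0" by auto
    obtain k where k: "r = c k" "F $$ k \<noteq> 0"
      using laurent_root_nonzero[OF m r(1)] unfolding c_def by blast
    have "G $$ (n - k) \<noteq> 0" using r(2) by (simp add: k qc Fc)
    then have "fls_subdegree G \<le> n - k" by (rule fls_subdegree_leI)
    moreover have "fls_subdegree F \<le> k" using k(2) by (rule fls_subdegree_leI)
    ultimately show "r \<in> c ` I" by (auto simp: k I_def)
  qed
  have "sum ?h ?S = sum ?h (c ` I)"
    by (rule sum.mono_neutral_left) (use sub in \<open>auto simp: I_def\<close>)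
  also have "\<dots> = (\<Sum>i\<in>I. F $$ i * G $$ (n - i))"
    by (simp add: sum.reindex[OF inj] qc Fc)
  also have "\<dots> = (F * G) $$ n"
    by (simp add: fls_times_nth(2) I_def)
  also have "\<dots> = laurent_root m (F * G) q"
    using laurent_root_div[OF m, of "F * G" n] by (simp add: q)
  finally show ?thesis .
qed

instantiation puiseux :: "{zero, one, plus, minus, uminus, times}"
begin

lift_definition zero_puiseux :: puiseux is "\<lambda>_. 0"
proof -
  have "(\<lambda>_. 0) = laurent_root 1 0" by (simp add: laurent_root_def fun_eq_iff)
  then show "(\<lambda>_. 0) \<in> (\<Union>m\<in>{1..}. range (laurent_root m))"
    by (simp only: laurent_root_mem zero_less_one)
qed

lift_definition one_puiseux :: puiseux is "\<lambda>q. if q = 0 then 1 else 0"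
proof -
  have "(\<lambda>q. if q = 0 then 1 else 0) = laurent_root 1 1"
    by (auto simp: laurent_root_def fun_eq_iff elim!: Ints_cases)
  then show "(\<lambda>q. if q = 0 then 1 else 0) \<in> (\<Union>m\<in>{1..}. range (laurent_root m))"
    by (simp only: laurent_root_mem zero_less_one)
qed

lift_definition plus_puiseux :: "puiseux \<Rightarrow> puiseux \<Rightarrow> puiseux" is "\<lambda>f g q. f q + g q"
  by (erule laurent_root_common2, assumption) (simp only: laurent_root_add laurent_root_mem)

lift_definition minus_puiseux :: "puiseux \<Rightarrow> puiseux \<Rightarrow> puiseux" is "\<lambda>f g q. f q - g q"
  by (erule laurent_root_common2, assumption) (simp only: laurent_root_diff laurent_root_mem)

lift_definition uminus_puiseux :: "puiseux \<Rightarrow> puiseux" is "\<lambda>f q. - f q"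
proof -
  fix f assume "f \<in> (\<Union>m\<in>{1..}. range (laurent_root m))"
  then obtain m F where "m > 0" "f = laurent_root m F" by (auto simp: Suc_le_eq)
  then show "(\<lambda>q. - f q) \<in> (\<Union>m\<in>{1..}. range (laurent_root m))"
    by (simp only: laurent_root_uminus laurent_root_mem)
qed

lift_definition times_puiseux :: "puiseux \<Rightarrow> puiseux \<Rightarrow> puiseux"
  is "\<lambda>f g q. \<Sum>r | f r \<noteq> 0 \<and> g (q - r) \<noteq> 0. f r * g (q - r)"
  by (erule laurent_root_common2, assumption) (simp only: laurent_root_mult laurent_root_mem)

instance ..

end

lift_definition puiseux_of_fls :: "nat \<Rightarrow> real fls \<Rightarrow> puiseux"
  is "\<lambda>m. laurent_root (if m = 0 then 1 else m)"
  using laurent_root_mem by simp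

lemma puiseux_coeff_of_fls: "m > 0 \<Longrightarrow> puiseux_coeff (puiseux_of_fls m F) = laurent_root m F"
  by transfer simp

lemma puiseux_cases1:
  obtains m F where "m > 0" "x = puiseux_of_fls m F"
proof -
  obtain m F where "m > 0" "puiseux_coeff x = laurent_root m F"
    using puiseux_coeff[of x] by (auto simp: Suc_le_eq)
  then show thesis
    by (intro that[of m F]) (simp_all add: puiseux_coeff_inject[symmetric] puiseux_coeff_of_fls)
qed

lemma puiseux_of_fls_compose_power:
  "m > 0 \<Longrightarrow> d > 0 \<Longrightarrow> puiseux_of_fls (m * d) (fls_compose_power F d) = puiseux_of_fls m F"
  by (simp add: puiseux_coeff_inject[symmetric] puiseux_coeff_of_fls laurent_root_compose_power)

lemma puiseux_cases2:
  obtains m F G where "m > 0" "x = puiseux_of_fls m F" "y = puiseux_of_fls m G"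
proof -
  obtain m F where 1: "m > 0" "x = puiseux_of_fls m F" by (rule puiseux_cases1)
  obtain n G where 2: "n > 0" "y = puiseux_of_fls n G" by (rule puiseux_cases1)
  show thesis
    by (rule that[of "m * n" "fls_compose_power F n" "fls_compose_power G m"])
       (use 1 2 puiseux_of_fls_compose_power[of m n F] puiseux_of_fls_compose_power[of n m G]
        in \<open>simp_all add: mult.commute\<close>)
qed

lemma puiseux_cases3:
  obtains m F G H where "m > 0"
    "x = puiseux_of_fls m F" "y = puiseux_of_fls m G" "z = puiseux_of_fls m H"
proof -
  obtain m F G where 1: "m > 0" "x = puiseux_of_fls m F" "y = puiseux_of_fls m G"
    by (rule puiseux_cases2)
  obtain n H where 2: "n > 0" "z = puiseux_of_fls n H" by (rule puiseux_cases1)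
  show thesis
    by (rule that[of "m * n" "fls_compose_power F n" "fls_compose_power G n" "fls_compose_power H m"])
       (use 1 2 puiseux_of_fls_compose_power[of m n F] puiseux_of_fls_compose_power[of m n G]
          puiseux_of_fls_compose_power[of n m H]
        in \<open>simp_all add: mult.commute\<close>)
qed

lemma puiseux_of_fls_inject: "m > 0 \<Longrightarrow> puiseux_of_fls m F = puiseux_of_fls m G \<longleftrightarrow> F = G"
  by (auto simp: puiseux_coeff_inject[symmetric] puiseux_coeff_of_fls)
     (metis fls_eqI laurent_root_div)

lemma puiseux_of_fls_0: "m > 0 \<Longrightarrow> puiseux_of_fls m 0 = 0"
  by transfer (auto simp: laurent_root_def)

lemma puiseux_of_fls_1: "m > 0 \<Longrightarrow> puiseux_of_fls m 1 = 1"
  by transfer (auto simp: laurent_root_def fun_eq_iff elim!: Ints_cases)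

lemma puiseux_of_fls_add:
  "m > 0 \<Longrightarrow> puiseux_of_fls m F + puiseux_of_fls m G = puiseux_of_fls m (F + G)"
  by transfer (auto simp: laurent_root_add)

lemma puiseux_of_fls_diff:
  "m > 0 \<Longrightarrow> puiseux_of_fls m F - puiseux_of_fls m G = puiseux_of_fls m (F - G)"
  by transfer (auto simp: laurent_root_diff)

lemma puiseux_of_fls_uminus: "m > 0 \<Longrightarrow> - puiseux_of_fls m F = puiseux_of_fls m (- F)"
  by transfer (auto simp: laurent_root_uminus)

lemma puiseux_of_fls_mult:
  "m > 0 \<Longrightarrow> puiseux_of_fls m F * puiseux_of_fls m G = puiseux_of_fls m (F * G)"
  by transfer (simp add: laurent_root_mult)

lemmas puiseux_of_fls_simps =
  puiseux_of_fls_add puiseux_of_fls_diff puiseux_of_fls_uminus puiseux_of_fls_mult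

lemma puiseux_mult_inverse_ex:
  assumes "(x :: puiseux) \<noteq> 0"
  shows "\<exists>y. y * x = 1"
proof -
  obtain m F where x: "m > 0" "x = puiseux_of_fls m F" by (rule puiseux_cases1)
  have "F \<noteq> 0" using assms x puiseux_of_fls_0 by auto
  then have "puiseux_of_fls m (inverse F) * x = 1"
    using x by (simp add: puiseux_of_fls_mult puiseux_of_fls_1)
  then show ?thesis by blast
qed

instance puiseux :: comm_ring_1
proof
  fix a b c :: puiseux
  show "a + b + c = a + (b + c)"
    by (rule puiseux_cases3[of a b c]) (simp add: puiseux_of_fls_simps add_ac)
  show "a * b * c = a * (b * c)"
    by (rule puiseux_cases3[of a b c]) (simp add: puiseux_of_fls_simps mult_ac)
  show "(a + b) * c = a * c + b * c"
    by (rule puiseux_cases3[of a b c]) (simp add: puiseux_of_fls_simps distrib_right)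
  show "a + b = b + a"
    by (rule puiseux_cases2[of a b]) (simp add: puiseux_of_fls_simps add_ac)
  show "a * b = b * a"
    by (rule puiseux_cases2[of a b]) (simp add: puiseux_of_fls_simps mult_ac)
  show "a - b = a + - b"
    by (rule puiseux_cases2[of a b]) (simp add: puiseux_of_fls_simps)
  show "0 + a = a"
    by (rule puiseux_cases1[of a])
       (simp add: puiseux_of_fls_simps flip: puiseux_of_fls_0)
  show "- a + a = 0"
    by (rule puiseux_cases1[of a]) (simp add: puiseux_of_fls_simps puiseux_of_fls_0)
  show "1 * a = a"
    by (rule puiseux_cases1[of a])
       (simp add: puiseux_of_fls_simps flip: puiseux_of_fls_1)
  show "(0 :: puiseux) \<noteq> 1"
    using puiseux_of_fls_inject[of 1 0 1] by (simp add: puiseux_of_fls_0 puiseux_of_fls_1)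
qed

instantiation puiseux :: inverse
begin

definition inverse_puiseux :: "puiseux \<Rightarrow> puiseux" where
  "inverse_puiseux x = (if x = 0 then 0 else (SOME y. y * x = 1))"

definition divide_puiseux :: "puiseux \<Rightarrow> puiseux \<Rightarrow> puiseux" where
  "divide_puiseux x y = x * inverse y"

instance ..

end

instance puiseux :: field
proof
  fix a b :: puiseux
  show "a \<noteq> 0 \<Longrightarrow> inverse a * a = 1"
    using someI_ex[OF puiseux_mult_inverse_ex[of a]] by (simp add: inverse_puiseux_def)
qed (simp_all add: divide_puiseux_def inverse_puiseux_def)

text \<open>Only meaningful for nonzero series, whose support has a least element.\<close>

definition puiseux_val :: "puiseux \<Rightarrow> rat" where
  "puiseux_val x = (LEAST q. puiseux_coeff x q \<noteq> 0)"

lemma puiseux_val_of_fls: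
  assumes "m > 0" "F \<noteq> 0"
  shows "puiseux_val (puiseux_of_fls m F) = of_int (fls_subdegree F) / of_nat m"
  unfolding puiseux_val_def puiseux_coeff_of_fls[OF assms(1)]
proof (rule Least_equality)
  show "laurent_root m F (of_int (fls_subdegree F) / of_nat m) \<noteq> 0"
    using assms by (simp add: laurent_root_div)
next
  fix q assume "laurent_root m F q \<noteq> 0"
  then obtain k where k: "q = of_int k / of_nat m" "F $$ k \<noteq> 0"
    using laurent_root_nonzero[OF assms(1)] by blast
  have "fls_subdegree F \<le> k" using k(2) by (rule fls_subdegree_leI)
  then show "of_int (fls_subdegree F) / of_nat m \<le> q"
    using assms by (simp add: k divide_right_mono)
qed

lemma puiseux_lead_of_fls:
  assumes "m > 0"
  shows "puiseux_coeff (puiseux_of_fls m F) (puiseux_val (puiseux_of_fls m F)) =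
           F $$ fls_subdegree F"
proof (cases "F = 0")
  case True
  then show ?thesis using assms by (simp add: puiseux_coeff_of_fls laurent_root_def)
next
  case False
  then show ?thesis
    using assms by (simp add: puiseux_val_of_fls puiseux_coeff_of_fls laurent_root_div)
qed

lemma fls_lead_add_pos:
  fixes F G :: "real fls"
  assumes "F $$ fls_subdegree F > 0" "G $$ fls_subdegree G > 0"
  shows "(F + G) $$ fls_subdegree (F + G) > 0"
proof -
  define d where "d = min (fls_subdegree F) (fls_subdegree G)"
  have "H $$ d \<ge> 0" if "H $$ fls_subdegree H > 0" "d \<le> fls_subdegree H" for H :: "real fls"
    using that by (cases "d = fls_subdegree H") auto
  then have "F $$ d \<ge> 0" "G $$ d \<ge> 0"
    using assms by (auto simp: d_def)
  moreover have "F $$ d > 0 \<or> G $$ d > 0"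
    using assms by (auto simp: d_def min_def)
  ultimately have pos: "(F + G) $$ d > 0" by auto
  have "fls_subdegree (F + G) = d"
    by (rule fls_subdegree_eqI) (use pos in \<open>auto simp: d_def\<close>)
  then show ?thesis using pos by simp
qed

instantiation puiseux :: linordered_field
begin

definition less_puiseux :: "puiseux \<Rightarrow> puiseux \<Rightarrow> bool" where
  "x < y \<longleftrightarrow> puiseux_coeff (y - x) (puiseux_val (y - x)) > 0"

definition less_eq_puiseux :: "puiseux \<Rightarrow> puiseux \<Rightarrow> bool" where
  "less_eq_puiseux x y \<longleftrightarrow> x < y \<or> x = y"

definition abs_puiseux :: "puiseux \<Rightarrow> puiseux" where
  "abs_puiseux x = (if x < 0 then - x else x)"

definition sgn_puiseux :: "puiseux \<Rightarrow> puiseux" where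
  "sgn_puiseux x = (if x = 0 then 0 else if 0 < x then 1 else - 1)"

lemma less_puiseux_of_fls:
  "m > 0 \<Longrightarrow> puiseux_of_fls m F < puiseux_of_fls m G \<longleftrightarrow> (G - F) $$ fls_subdegree (G - F) > 0"
  unfolding less_puiseux_def by (simp add: puiseux_of_fls_diff puiseux_lead_of_fls)

lemma less_puiseux_trans:
  assumes "(x :: puiseux) < y" "y < z"
  shows "x < z"
proof -
  obtain m F G H where *: "m > 0"
    "x = puiseux_of_fls m F" "y = puiseux_of_fls m G" "z = puiseux_of_fls m H"
    by (rule puiseux_cases3)
  have "((G - F) + (H - G)) $$ fls_subdegree ((G - F) + (H - G)) > 0"
    using assms unfolding * less_puiseux_of_fls[OF *(1)] by (rule fls_lead_add_pos)
  moreover have "(G - F) + (H - G) = H - F" by simp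
  ultimately show ?thesis unfolding * less_puiseux_of_fls[OF *(1)] by (simp only:)
qed

lemma less_puiseux_irrefl: "\<not> (x :: puiseux) < x"
  by (rule puiseux_cases1[of x]) (simp add: less_puiseux_of_fls)

lemma less_puiseux_linear: "(x :: puiseux) < y \<or> x = y \<or> y < x"
proof -
  obtain m F G where *: "m > 0" "x = puiseux_of_fls m F" "y = puiseux_of_fls m G"
    by (rule puiseux_cases2)
  have "(G - F) $$ fls_subdegree (G - F) = - ((F - G) $$ fls_subdegree (F - G))"
    using fls_subdegree_minus_sym[of F G] by simp
  moreover have "(F - G) $$ fls_subdegree (F - G) = 0 \<Longrightarrow> F = G"
    by (simp only: nth_fls_subdegree_zero_iff right_minus_eq)
  ultimately show ?thesis using * by (auto simp: less_puiseux_of_fls)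
qed

lemma mult_pos_puiseux:
  assumes "(0 :: puiseux) < x" "0 < y"
  shows "0 < x * y"
proof -
  obtain m F G where *: "m > 0" "x = puiseux_of_fls m F" "y = puiseux_of_fls m G"
    by (rule puiseux_cases2)
  have pos: "0 < puiseux_of_fls m H \<longleftrightarrow> H $$ fls_subdegree H > 0" for H
    using less_puiseux_of_fls[OF *(1), of 0 H] *(1) by (simp add: puiseux_of_fls_0)
  have FG: "F $$ fls_subdegree F > 0" "G $$ fls_subdegree G > 0"
    using assms pos * by auto
  have "F \<noteq> 0" "G \<noteq> 0" using FG by auto
  then have "(F * G) $$ fls_subdegree (F * G) = F $$ fls_subdegree F * G $$ fls_subdegree G"
    by (simp add: fls_times_base)
  then show ?thesis using FG * by (simp add: puiseux_of_fls_mult pos)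
qed

instance
proof
  fix x y z :: puiseux
  show "x < y \<longleftrightarrow> x \<le> y \<and> \<not> y \<le> x"
    unfolding less_eq_puiseux_def using less_puiseux_trans less_puiseux_irrefl by metis
  show "x \<le> x" by (simp add: less_eq_puiseux_def)
  show "x \<le> y \<Longrightarrow> y \<le> z \<Longrightarrow> x \<le> z"
    unfolding less_eq_puiseux_def using less_puiseux_trans by metis
  show "x \<le> y \<Longrightarrow> y \<le> x \<Longrightarrow> x = y"
    unfolding less_eq_puiseux_def using less_puiseux_trans less_puiseux_irrefl by metis
  show "x \<le> y \<or> y \<le> x"
    unfolding less_eq_puiseux_def using less_puiseux_linear by metis
  show "x \<le> y \<Longrightarrow> z + x \<le> z + y"
    unfolding less_eq_puiseux_def less_puiseux_def by auto
  show "x < y \<Longrightarrow> 0 < z \<Longrightarrow> z * x < z * y"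
    using mult_pos_puiseux[of z "y - x"] unfolding less_puiseux_def
    by (simp add: right_diff_distrib)
qed (simp_all add: abs_puiseux_def sgn_puiseux_def)

end

section \<open>Polynomials and ideals\<close>

text \<open>
  Polynomials over \<^typ>\<open>puiseux\<close> in variables indexed by the finite type \<open>'n\<close>, as finitely
  supported maps from exponent vectors to coefficients; \<^const>\<open>Poly_Mapping.keys\<close> is the support.
\<close>

type_synonym 'n kpoly = "('n \<Rightarrow>\<^sub>0 nat) \<Rightarrow>\<^sub>0 puiseux"

definition Var :: "'n \<Rightarrow> 'n kpoly" where
  "Var i = Poly_Mapping.single (Poly_Mapping.single i 1) 1"

definition poly_eval :: "'n::finite kpoly \<Rightarrow> puiseux ^ 'n \<Rightarrow> puiseux" where
  "poly_eval F x =
     (\<Sum>l\<in>Poly_Mapping.keys F. Poly_Mapping.lookup F l * (\<Prod>k\<in>UNIV. (x $ k) ^ Poly_Mapping.lookup l k))"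

text \<open>An ideal is a submodule of the ring regarded as a module over itself.\<close>

abbreviation is_ideal :: "'n kpoly set \<Rightarrow> bool" where
  "is_ideal \<equiv> module.subspace (*)"

abbreviation ideal_gen :: "'n kpoly set \<Rightarrow> 'n kpoly set" where
  "ideal_gen \<equiv> module.span (*)"

lemma module_kpoly: "module ((*) :: 'n kpoly \<Rightarrow> _)"
  by unfold_locales (simp_all add: algebra_simps)

definition zero_set :: "'n::finite kpoly set \<Rightarrow> (puiseux ^ 'n) set" where
  "zero_set I = {x. \<forall>F\<in>I. poly_eval F x = 0}"

definition real_radical_of :: "'n kpoly set \<Rightarrow> 'n kpoly set" where
  "real_radical_of I = {F. \<exists>m>0. \<exists>Gs. F ^ (2 * m) + (\<Sum>G\<leftarrow>Gs. G ^ 2) \<in> I}"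

definition real_radical :: "'n kpoly set \<Rightarrow> bool" where
  "real_radical I \<longleftrightarrow> is_ideal I \<and> I = real_radical_of I"

section \<open>Real tropicalization\<close>

text \<open>
  The type \<^typ>\<open>int\<close> carries the discrete topology, so that \<open>TR\<close> has the product topology as a
  subspace of \<^typ>\<open>int \<times> real\<close>.
\<close>

definition TR :: "(int \<times> real) set" where
  "TR = {1, -1} \<times> UNIV"

definition TR_space :: "((int \<times> real) ^ 'n) set" where
  "TR_space = {p. \<forall>k. p $ k \<in> TR}"

definition trop :: "puiseux \<Rightarrow> int \<times> real" where
  "trop x = (if x > 0 then 1 else -1, real_of_rat (puiseux_val x))"

definition trop_variety :: "'n::finite kpoly set \<Rightarrow> ((int \<times> real) ^ 'n) set" where
  "trop_variety I =
     top_of_set TR_space closure_of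
       ((\<lambda>x. \<chi> k. trop (x $ k)) ` (zero_set I \<inter> {x. \<forall>k. x $ k \<noteq> 0}))"

definition trop_weight :: "'n::finite kpoly \<Rightarrow> (int \<times> real) ^ 'n \<Rightarrow> ('n \<Rightarrow>\<^sub>0 nat) \<Rightarrow> real" where
  "trop_weight F p l =
     real_of_rat (puiseux_val (Poly_Mapping.lookup F l)) +
     (\<Sum>k\<in>UNIV. real (Poly_Mapping.lookup l k) * snd (p $ k))"

definition trop_sign :: "'n::finite kpoly \<Rightarrow> (int \<times> real) ^ 'n \<Rightarrow> ('n \<Rightarrow>\<^sub>0 nat) \<Rightarrow> int" where
  "trop_sign F p l =
     fst (trop (Poly_Mapping.lookup F l)) * (\<Prod>k\<in>UNIV. fst (p $ k) ^ Poly_Mapping.lookup l k)"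

definition real_trop_hypersurface :: "'n::finite kpoly \<Rightarrow> ((int \<times> real) ^ 'n) set" where
  "real_trop_hypersurface F =
     {p \<in> TR_space. \<exists>i\<in>Poly_Mapping.keys F. \<exists>j\<in>Poly_Mapping.keys F. i \<noteq> j \<and>
        trop_weight F p i = Min (trop_weight F p ` Poly_Mapping.keys F) \<and>
        trop_weight F p j = Min (trop_weight F p ` Poly_Mapping.keys F) \<and>
        trop_sign F p i = 1 \<and> trop_sign F p j = -1}"

text \<open>Intersecting with \<open>TR_space\<close> only matters for the empty basis (of the zero ideal).\<close>

definition real_tropical_basis :: "'n::finite kpoly set \<Rightarrow> 'n kpoly set \<Rightarrow> bool" where
  "real_tropical_basis B I \<longleftrightarrow>
     finite B \<and> 0 \<notin> B \<and> ideal_gen B = I \<and>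
     trop_variety I = TR_space \<inter> (\<Inter>F\<in>B. real_trop_hypersurface F)"

end

theory Submission
  imports Defs
begin

text \<open>
  Write \<open>F = (x + y) (x - y)\<^sup>2 + 2 (x + y - 2)\<^sup>2\<close>.

  Real radical: in \<open>s = x + y\<close>, \<open>d = x - y\<close> one has \<open>F = 2 s\<^sup>2 + (d\<^sup>2 - 8) s + 8\<close>, so division by \<open>F\<close>
  leaves a remainder \<open>A(d) s + B(d)\<close>. The zeros \<open>s = -2 / w\<^sup>2\<close>, \<open>d = -2 (w + 1 / w)\<close> of \<open>F\<close> take
  infinitely many values of \<open>d\<close>, each with two different values of \<open>s\<close> (exchange \<open>w\<close> and \<open>1 / w\<close>), so
  a polynomial vanishing at all of them has \<open>A = B = 0\<close>.

  No basis: the only zero of \<open>F\<close> in the open positive quadrant is \<open>(1, 1)\<close>, so the positive point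
  with \<open>|p| = (-1, -1)\<close> is not in the tropical variety. But the initial form of \<open>F\<close> there is
  \<open>(x + y) (x - y)\<^sup>2\<close>, which vanishes at \<open>(1, 1)\<close>, hence so does the initial form of every nonzero
  multiple of \<open>F\<close>: it has terms of both signs, and \<open>p\<close> lies in every \<open>real_trop_hypersurface\<close>.
\<close>

section \<open>Leading coefficients of Puiseux series\<close>

text \<open>The number \<open>c\<close> may be \<open>0\<close>: only the valuation bound \<open>m\<close> is asserted then.\<close>

definition has_lead :: "puiseux \<Rightarrow> rat \<Rightarrow> real \<Rightarrow> bool" where
  "has_lead x m c \<longleftrightarrow> (\<forall>q<m. puiseux_coeff x q = 0) \<and> puiseux_coeff x m = c"

lemma has_lead_zero: "has_lead 0 m 0"
  by (simp add: has_lead_def zero_puiseux.rep_eq)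

lemma has_lead_one: "has_lead 1 0 1"
  by (simp add: has_lead_def one_puiseux.rep_eq)

lemma has_lead_add: "has_lead x m c \<Longrightarrow> has_lead y m d \<Longrightarrow> has_lead (x + y) m (c + d)"
  by (simp add: has_lead_def plus_puiseux.rep_eq)

lemma has_lead_diff: "has_lead x m c \<Longrightarrow> has_lead y m d \<Longrightarrow> has_lead (x - y) m (c - d)"
  by (simp add: has_lead_def minus_puiseux.rep_eq)

lemma has_lead_weaken: "has_lead x m c \<Longrightarrow> n < m \<Longrightarrow> has_lead x n 0"
  by (simp add: has_lead_def)

lemma has_lead_sum:
  "(\<And>i. i \<in> A \<Longrightarrow> has_lead (f i) m (c i)) \<Longrightarrow> has_lead (sum f A) m (sum c A)"
  by (induction A rule: infinite_finite_induct) (simp_all add: has_lead_zero has_lead_add)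

text \<open>A nonzero term of the convolution at exponent \<open>q\<close> needs
  \<open>r >= m\<close> and \<open>q - r >= n\<close>. No such \<open>r\<close> exists below
  \<open>m + n\<close>, and at \<open>m + n\<close> only \<open>r = m\<close> can
  contribute.\<close>

lemma has_lead_mult:
  assumes "has_lead x m c" "has_lead y n d"
  shows "has_lead (x * y) (m + n) (c * d)"
proof -
  let ?S = "\<lambda>q. {r. puiseux_coeff x r \<noteq> 0 \<and> puiseux_coeff y (q - r) \<noteq> 0}"
  have *: "r \<ge> m \<and> q - r \<ge> n" if "r \<in> ?S q" for r q
    using that assms unfolding has_lead_def by (auto simp: not_less[symmetric])
  have "?S q = {}" if "q < m + n" for q
    using *[of _ q] that by fastforce
  then have "puiseux_coeff (x * y) q = 0" if "q < m + n" for q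
    unfolding times_puiseux.rep_eq using that by (simp only: sum.empty)
  moreover have "puiseux_coeff (x * y) (m + n) = c * d"
  proof -
    have "?S (m + n) \<subseteq> {m}" using *[of _ "m + n"] by fastforce
    then have "puiseux_coeff (x * y) (m + n) =
        (\<Sum>r\<in>{m}. puiseux_coeff x r * puiseux_coeff y (m + n - r))"
      unfolding times_puiseux.rep_eq by (intro sum.mono_neutral_left) auto
    then show ?thesis using assms by (simp add: has_lead_def)
  qed
  ultimately show ?thesis by (simp add: has_lead_def)
qed

lemma has_lead_power: "has_lead x m c \<Longrightarrow> has_lead (x ^ k) (of_nat k * m) (c ^ k)"
proof (induction k)
  case (Suc k)
  have "has_lead (x * x ^ k) (m + of_nat k * m) (c * c ^ k)"
    using has_lead_mult Suc by blast
  then show ?case by (simp add: distrib_right)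
qed (simp add: has_lead_one)

text \<open>Serves to compare two computations of the same value: a nonzero coefficient at
  \<open>m\<close> cannot lie in the range below \<open>n\<close> where all coefficients
  vanish.\<close>

lemma has_lead_unique_le:
  "has_lead x m c \<Longrightarrow> c \<noteq> 0 \<Longrightarrow> has_lead x n d \<Longrightarrow> n \<le> m"
  by (auto simp: has_lead_def not_less[symmetric])

lemma has_lead_val:
  assumes "x \<noteq> 0"
  shows "has_lead x (puiseux_val x) (puiseux_coeff x (puiseux_val x))"
    and puiseux_coeff_val_nonzero: "puiseux_coeff x (puiseux_val x) \<noteq> 0"
proof -
  obtain m f where x: "m > 0" "x = puiseux_of_fls m f" by (rule puiseux_cases1)
  then have f: "f \<noteq> 0" using assms puiseux_of_fls_0 by auto
  show "puiseux_coeff x (puiseux_val x) \<noteq> 0"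
    using x f by (simp add: puiseux_lead_of_fls)
  have "puiseux_coeff x q = 0" if "q < puiseux_val x" for q
  proof (rule ccontr)
    assume "puiseux_coeff x q \<noteq> 0"
    then have "puiseux_val x \<le> q"
      unfolding x(2) puiseux_val_of_fls[OF x(1) f] puiseux_coeff_of_fls[OF x(1)]
      by (auto elim!: laurent_root_nonzero[OF x(1)] intro!: divide_right_mono fls_subdegree_leI)
    then show False using that by simp
  qed
  then show "has_lead x (puiseux_val x) (puiseux_coeff x (puiseux_val x))"
    by (simp add: has_lead_def)
qed

lemma puiseux_val_one: "puiseux_val 1 = 0"
  using puiseux_val_of_fls[of 1 1] by (simp add: puiseux_of_fls_1)

lemma puiseux_pos_iff: "0 < x \<longleftrightarrow> puiseux_coeff x (puiseux_val x) > 0"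
  by (simp add: less_puiseux_def)

text \<open>The series \<open>a / t\<close>. Substituting such series for the variables makes the
  initial form in weight (-1, -1) appear as a leading coefficient.\<close>

definition puiseux_pole :: "real \<Rightarrow> puiseux" where
  "puiseux_pole a = puiseux_of_fls 1 (fls_const a * fls_X_inv)"

lemma has_lead_pole: "has_lead (puiseux_pole a) (-1) a"
proof -
  have "\<lfloor>- 1 :: rat\<rfloor> = - 1" by (metis floor_of_int of_int_1 of_int_minus)
  then have "puiseux_coeff (puiseux_pole a) q = (if q = -1 then a else 0)" for q
    by (auto simp: puiseux_pole_def puiseux_coeff_of_fls laurent_root_def elim!: Ints_cases)
  then show ?thesis by (simp add: has_lead_def)
qed

section \<open>Evaluation of polynomials\<close>

lemma poly_eval_superset:
  assumes "finite S" "Poly_Mapping.keys P \<subseteq> S"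
  shows "poly_eval P z =
    (\<Sum>l\<in>S. Poly_Mapping.lookup P l * (\<Prod>k\<in>UNIV. (z $ k) ^ Poly_Mapping.lookup l k))"
  unfolding poly_eval_def
  by (rule sum.mono_neutral_left) (use assms in \<open>auto simp: in_keys_iff\<close>)

lemma poly_eval_add: "poly_eval (P + Q) z = poly_eval P z + poly_eval Q z"
proof -
  let ?S = "Poly_Mapping.keys P \<union> Poly_Mapping.keys Q"
  have "Poly_Mapping.keys (P + Q) \<subseteq> ?S" by (rule Poly_Mapping.keys_add)
  then show ?thesis
    by (simp add: poly_eval_superset[of ?S] lookup_add distrib_right sum.distrib)
qed

lemma poly_eval_zero: "poly_eval 0 z = 0"
  by (simp add: poly_eval_def)

lemma poly_eval_single:
  "poly_eval (Poly_Mapping.single l c) z = c * (\<Prod>k\<in>UNIV. (z $ k) ^ Poly_Mapping.lookup l k)"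
  by (subst poly_eval_superset[of "{l}"]) auto

lemma poly_eval_diff: "poly_eval (P - Q) z = poly_eval P z - poly_eval Q z"
  using poly_eval_add[of "P - Q" Q z] by simp

text \<open>Trades the updates of \<open>update_induct\<close> for sums, with which evaluation and
  multiplication are compatible.\<close>

lemma poly_mapping_add_induct [case_names zero single_add]:
  assumes "Q 0" "\<And>P l c. Q P \<Longrightarrow> Q (Poly_Mapping.single l c + P)"
  shows "Q P"
proof (induction P rule: update_induct)
  case const
  then show ?case by (rule assms(1))
next
  case (update P l c)
  have "Poly_Mapping.update l c P = Poly_Mapping.single l c + P"
    using update.hyps
    by (intro poly_mapping_eqI) (auto simp: lookup_update lookup_add lookup_single in_keys_iff when_def)
  then show ?case using assms(2)[OF update.IH] by simp
qed

lemma poly_eval_mult: "poly_eval (P * Q) z = poly_eval P z * poly_eval Q z"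
proof (induction P rule: poly_mapping_add_induct)
  case zero
  then show ?case by (simp add: poly_eval_zero)
next
  case (single_add P l c)
  have "poly_eval (Poly_Mapping.single l c * Q) z = poly_eval (Poly_Mapping.single l c) z * poly_eval Q z"
  proof (induction Q rule: poly_mapping_add_induct)
    case zero
    then show ?case by (simp add: poly_eval_zero)
  next
    case (single_add Q l' c')
    then show ?case
      by (simp add: distrib_left poly_eval_add mult_single poly_eval_single lookup_add power_add
          prod.distrib mult_ac)
  qed
  then show ?case using single_add by (simp add: distrib_right poly_eval_add)
qed

lemma poly_eval_one: "poly_eval 1 z = 1"
  using poly_eval_single[of 0 1 z] by simp

lemma poly_eval_power: "poly_eval (P ^ k) z = poly_eval P z ^ k"
  by (induction k) (simp_all add: poly_eval_one poly_eval_mult)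

lemma poly_eval_numeral: "poly_eval (numeral k) z = numeral k"
  using poly_eval_single[of 0 "numeral k" z] by (simp add: single_numeral)

lemma poly_eval_Var: "poly_eval (Var i) z = z $ i"
proof -
  have "(\<Prod>k\<in>UNIV. (z $ k) ^ Poly_Mapping.lookup (Poly_Mapping.single i 1) k) =
        (\<Prod>k\<in>UNIV. if k = i then z $ k else 1)"
    by (rule prod.cong) (auto simp: lookup_single when_def)
  then show ?thesis by (simp add: Var_def poly_eval_single)
qed

lemmas poly_eval_simps = poly_eval_add poly_eval_diff poly_eval_mult poly_eval_power
  poly_eval_numeral poly_eval_Var poly_eval_one poly_eval_zero poly_eval_single

text \<open>The Puiseux series form an ordered field, so a vanishing sum of squares has only
  vanishing terms.\<close>

lemma poly_eval_eq_0_if_sum_of_squares: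
  assumes "poly_eval (P ^ (2 * m) + (\<Sum>G\<leftarrow>Gs. G ^ 2)) z = 0"
  shows "poly_eval P z = 0"
proof -
  have "poly_eval (\<Sum>G\<leftarrow>Gs. G ^ 2) z \<ge> 0"
    by (induction Gs) (simp_all add: poly_eval_simps)
  moreover have "(poly_eval P z ^ m) ^ 2 \<ge> 0" by simp
  moreover have "(poly_eval P z ^ m) ^ 2 + poly_eval (\<Sum>G\<leftarrow>Gs. G ^ 2) z = 0"
    using assms by (simp only: poly_eval_add poly_eval_power mult.commute[of 2 m] power_mult)
  ultimately have "(poly_eval P z ^ m) ^ 2 = 0"
    using add_nonneg_eq_0_iff by blast
  then show ?thesis by simp
qed

text \<open>Substitutes the multivariate polynomial \<open>d\<close> into \<open>A\<close>;
  \<open>Poly_Mapping.single 0\<close> embeds the coefficients as constants. It expresses remainders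
  that depend on \<open>x - y\<close> alone.\<close>

definition sub_poly :: "'n kpoly \<Rightarrow> puiseux poly \<Rightarrow> 'n kpoly" where
  "sub_poly d A = poly (map_poly (Poly_Mapping.single 0) A) d"

lemma sub_poly_0: "sub_poly d 0 = 0"
  by (simp add: sub_poly_def)

lemma sub_poly_pCons: "sub_poly d (pCons c A) = Poly_Mapping.single 0 c + d * sub_poly d A"
  by (simp add: sub_poly_def map_poly_pCons)

lemma sub_poly_add: "sub_poly d (A + B) = sub_poly d A + sub_poly d B"
proof (induction A B rule: poly_induct2)
  case (pCons a p b q)
  then show ?case by (simp add: sub_poly_pCons single_add algebra_simps)
qed (simp add: sub_poly_0)

lemma sub_poly_smult: "sub_poly d (smult c A) = Poly_Mapping.single 0 c * sub_poly d A"
  by (induction A) (simp_all add: sub_poly_0 sub_poly_pCons mult_single algebra_simps)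

lemma poly_eval_sub_poly: "poly_eval (sub_poly d A) z = poly A (poly_eval d z)"
  by (induction A) (simp_all add: sub_poly_0 sub_poly_pCons poly_eval_simps)

section \<open>The cubic is real radical\<close>

definition cubic :: "2 kpoly" where
  "cubic = (Var 1 + Var 2) * (Var 1 - Var 2)\<^sup>2 + 2 * (Var 1 + Var 2 - 2)\<^sup>2"

lemma poly_eval_cubic:
  "poly_eval cubic z = (z $ 1 + z $ 2) * (z $ 1 - z $ 2)\<^sup>2 + 2 * (z $ 1 + z $ 2 - 2)\<^sup>2"
  by (simp add: cubic_def poly_eval_simps)

lemma ideal_gen_cubic: "P \<in> ideal_gen {cubic} \<longleftrightarrow> (\<exists>Q. P = Q * cubic)"
  by (auto simp: module.span_singleton[OF module_kpoly])

text \<open>Builds a monomial from 1 by multiplying with variables and a constant, operations that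
  preserve divisibility with remainder in \<open>cubic_division\<close>.\<close>

lemma single_eq_Vars:
  fixes l :: "2 \<Rightarrow>\<^sub>0 nat"
  shows "Poly_Mapping.single l c =
    Poly_Mapping.single 0 c * Var 1 ^ Poly_Mapping.lookup l 1 * Var 2 ^ Poly_Mapping.lookup l 2"
proof -
  have pow: "Var i ^ k = Poly_Mapping.single (Poly_Mapping.single i k) 1" for i :: 2 and k
    by (induction k) (simp_all add: Var_def mult_single flip: single_add)
  have "l = Poly_Mapping.single 1 (Poly_Mapping.lookup l 1) + Poly_Mapping.single 2 (Poly_Mapping.lookup l 2)"
  proof (rule poly_mapping_eqI)
    fix k :: 2
    show "Poly_Mapping.lookup l k = Poly_Mapping.lookup (Poly_Mapping.single 1 (Poly_Mapping.lookup l 1) +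
        Poly_Mapping.single 2 (Poly_Mapping.lookup l 2)) k"
      using exhaust_2[of k] by (auto simp: lookup_add lookup_single)
  qed
  then show ?thesis by (simp add: pow mult_single)
qed

text \<open>The polynomials with such a presentation contain 1 and are closed under sums and under
  products with constants, \<open>d\<close> and \<open>s\<close>, hence under products with both
  variables. Only the product with \<open>s\<close> uses the cubic, to eliminate
  \<open>s * s\<close>.\<close>

lemma cubic_division:
  "\<exists>Q A B. P = Q * cubic + sub_poly (Var 1 - Var 2) A * (Var 1 + Var 2) + sub_poly (Var 1 - Var 2) B"
    (is "?div P")
proof -
  define s d :: "2 kpoly" where "s = Var 1 + Var 2" and "d = Var 1 - Var 2"
  let ?c = "Poly_Mapping.single 0 :: puiseux \<Rightarrow> 2 kpoly"
  \<comment> \<open>Polynomials cannot be divided by 2, so the constant polynomial \<open>h\<close>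
    stands for 1/2.\<close>
  define h where "h = ?c (1 / 2)"
  have h2: "h * 2 = 1"
    unfolding h_def by (simp add: mult_single flip: single_numeral)
  have h8: "8 * h = 4"
  proof -
    have "8 * h = (4 * 2) * h" by simp
    also have "\<dots> = 4 * (h * 2)" by (simp only: mult_ac)
    finally show ?thesis by (simp add: h2)
  qed
  have F: "cubic = s * d\<^sup>2 + 2 * (s - 2)\<^sup>2" by (simp add: cubic_def s_def d_def)
  have divI: "?div P" if "P = Q * cubic + sub_poly d A * s + sub_poly d B" for P Q A B
    using that by (auto simp: s_def d_def)
  have divE: "\<exists>Q A B. P = Q * cubic + sub_poly d A * s + sub_poly d B" if "?div P" for P
    using that by (simp add: s_def d_def)
  have add: "?div (P + P')" if P: "?div P" and P': "?div P'" for P P'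
  proof -
    obtain Q A B Q' A' B' where "P = Q * cubic + sub_poly d A * s + sub_poly d B"
      "P' = Q' * cubic + sub_poly d A' * s + sub_poly d B'"
      using divE[OF P] divE[OF P'] by blast
    then show ?thesis
      by (intro divI[of _ "Q + Q'" "A + A'" "B + B'"]) (simp add: sub_poly_add algebra_simps)
  qed
  have d: "?div (d * P)" if P: "?div P" for P
  proof -
    obtain Q A B where "P = Q * cubic + sub_poly d A * s + sub_poly d B"
      using divE[OF P] by blast
    then show ?thesis
      by (intro divI[of _ "d * Q" "pCons 0 A" "pCons 0 B"]) (simp add: sub_poly_pCons algebra_simps)
  qed
  have const: "?div (?c c * P)" if P: "?div P" for P c
  proof -
    obtain Q A B where "P = Q * cubic + sub_poly d A * s + sub_poly d B"
      using divE[OF P] by blast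
    then show ?thesis
      by (intro divI[of _ "?c c * Q" "smult c A" "smult c B"]) (simp add: sub_poly_smult algebra_simps)
  qed
  have s: "?div (s * P)" if div: "?div P" for P
  proof -
    obtain Q A B where P: "P = Q * cubic + sub_poly d A * s + sub_poly d B"
      using divE[OF div] by blast
    define a b where "a = sub_poly d A" and "b = sub_poly d B"
    have ss: "s * s = h * (cubic - (d\<^sup>2 - 8) * s - 8)"
    proof -
      have "cubic - (d\<^sup>2 - 8) * s - 8 = 2 * (s * s)"
        by (simp add: F power2_eq_square algebra_simps)
      then show ?thesis using h2 by (simp add: mult.assoc[symmetric])
    qed
    have "s * P = s * Q * cubic + a * (s * s) + b * s"
      by (simp add: P a_def b_def algebra_simps)
    also have "\<dots> = s * Q * cubic + a * (h * (cubic - (d\<^sup>2 - 8) * s - 8)) + b * s"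
      by (simp only: ss)
    also have "\<dots> = (s * Q + a * h) * cubic + (b - h * (d * (d * a)) + 8 * h * a) * s - 8 * h * a"
      by (simp add: power2_eq_square algebra_simps)
    also have "\<dots> = (s * Q + a * h) * cubic + (b - h * (d * (d * a)) + 4 * a) * s - 4 * a"
      by (simp only: h8)
    finally have "s * P = (s * Q + a * h) * cubic + (b - h * (d * (d * a)) + 4 * a) * s - 4 * a" .
    \<comment> \<open>The new coefficient of \<open>s\<close> is \<open>B - d^2 A / 2 + 4 A\<close>,
      the new constant part \<open>-4 A\<close>.\<close>
    moreover have "sub_poly d (B + (smult (- (1 / 2)) (pCons 0 (pCons 0 A)) + smult 4 A)) =
        b - h * (d * (d * a)) + 4 * a"
      by (simp only: sub_poly_add sub_poly_smult sub_poly_pCons a_def b_def h_def single_uminus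
          single_numeral) (simp add: algebra_simps)
    moreover have "sub_poly d (smult (-4) A) = - (4 * a)"
      by (simp only: sub_poly_smult a_def single_uminus single_numeral) simp
    ultimately show ?thesis
      by (intro divI[of _ "s * Q + a * h" "B + (smult (- (1 / 2)) (pCons 0 (pCons 0 A)) + smult 4 A)" "smult (-4) A"])
        simp
  qed
  have x: "Var 1 = h * (s + d)"
    using h2 by (simp add: s_def d_def mult.assoc[symmetric] flip: mult_2)
  have y: "Var 2 = h * (s + ?c (-1) * d)"
    using h2 by (simp add: s_def d_def single_uminus mult.assoc[symmetric] flip: mult_2)
  have X: "?div (Var 1 * P)" if "?div P" for P
  proof -
    have eq: "Var 1 * P = ?c (1/2) * (s * P + d * P)" by (simp add: x h_def algebra_simps)
    show ?thesis unfolding eq by (rule const[OF add[OF s[OF that] d[OF that]]])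
  qed
  have Y: "?div (Var 2 * P)" if "?div P" for P
  proof -
    have eq: "Var 2 * P = ?c (1/2) * (s * P + ?c (-1) * (d * P))" by (simp add: y h_def algebra_simps)
    show ?thesis unfolding eq by (rule const[OF add[OF s[OF that] const[OF d[OF that]]]])
  qed
  have one: "?div 1"
    by (rule divI[of _ 0 0 1]) (simp add: sub_poly_0 one_pCons sub_poly_pCons)
  have Xk: "?div (Var 1 ^ k * P)" and Yk: "?div (Var 2 ^ k * P)" if "?div P" for P k
    using that by (induction k) (simp_all only: power_0 mult_1_left power_Suc mult.assoc X Y)
  show ?thesis
  proof (induction P rule: poly_mapping_add_induct)
    case zero
    show ?case by (rule divI[of _ 0 0 0]) (simp add: sub_poly_0)
  next
    case (single_add P l c)
    have "?div (Poly_Mapping.single l c)"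
      using const[OF Xk[OF Yk[OF one]], of c "Poly_Mapping.lookup l 1" "Poly_Mapping.lookup l 2"]
      by (simp add: single_eq_Vars[of l c] mult.assoc)
    then show ?case using single_add by (rule add)
  qed
qed

text \<open>In \<open>s = x + y\<close> and \<open>d = x - y\<close> the curve is
  \<open>s d^2 = -2 (s - 2)^2\<close>. Its singular point (1, 1) is \<open>s = 2\<close>,
  \<open>d = 0\<close>; on the line \<open>d = w (s - 2)\<close> through it the remaining
  intersection has \<open>s = -2 / w^2\<close>.\<close>

definition cubic_param :: "puiseux \<Rightarrow> puiseux ^ 2" where
  "cubic_param w = vector [- 1 / w\<^sup>2 - 1 / w - w, - 1 / w\<^sup>2 + 1 / w + w]"

lemma cubic_param_sum: "cubic_param w $ 1 + cubic_param w $ 2 = - 2 / w\<^sup>2"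
  by (simp add: cubic_param_def)

lemma cubic_param_diff: "cubic_param w $ 1 - cubic_param w $ 2 = - 2 * (w + 1 / w)"
  by (simp add: cubic_param_def algebra_simps)

lemma poly_eval_cubic_param: "w \<noteq> 0 \<Longrightarrow> poly_eval cubic (cubic_param w) = 0"
  unfolding poly_eval_cubic cubic_param_sum cubic_param_diff
  by (simp add: field_simps power2_eq_square)

lemma ideal_gen_cubic_if_vanishing:
  assumes van: "\<And>w. w \<noteq> 0 \<Longrightarrow> poly_eval P (cubic_param w) = 0"
  shows "P \<in> ideal_gen {cubic}"
proof -
  obtain Q A B where P: "P = Q * cubic + sub_poly (Var 1 - Var 2) A * (Var 1 + Var 2)
      + sub_poly (Var 1 - Var 2) B"
    using cubic_division by blast
  define d where "d w = - 2 * (w + 1 / w)" for w :: puiseux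
  have eq: "poly A (d w) * (- 2 / w\<^sup>2) + poly B (d w) = 0" if "w \<noteq> 0" for w
    using van[OF that] poly_eval_cubic_param[OF that] unfolding P
    by (simp add: poly_eval_simps poly_eval_sub_poly cubic_param_sum cubic_param_diff d_def)
  have roots: "poly A (d w) = 0 \<and> poly B (d w) = 0" if "w > 1" for w
  proof -
    \<comment> \<open>Subtracting the equations at \<open>w\<close> and \<open>1 / w\<close>, which
      share \<open>d w\<close>, eliminates \<open>B\<close>; for \<open>w > 1\<close> the factor
      \<open>w^2 - 1 / w^2\<close> left on \<open>A\<close> is nonzero.\<close>
    have "d (1 / w) = d w" by (simp add: d_def)
    then have "poly A (d w) * (- 2 * w\<^sup>2) + poly B (d w) = 0"
      using eq[of "1 / w"] that by (simp add: power_divide)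
    moreover have e: "poly A (d w) * (- 2 / w\<^sup>2) + poly B (d w) = 0" using eq[of w] that by simp
    ultimately have "poly A (d w) * (w\<^sup>2 - 1 / w\<^sup>2) = 0" by (simp add: algebra_simps)
    moreover have "w\<^sup>2 > 1" using that by (simp add: one_less_power)
    then have "w\<^sup>2 > 1 / w\<^sup>2"
      by (intro less_trans[of "1 / w\<^sup>2" 1 "w\<^sup>2"]) (simp_all only: divide_less_eq_1, simp)
    ultimately have "poly A (d w) = 0" by simp
    then show ?thesis using e by simp
  qed
  \<comment> \<open>Restricting to \<open>w > 1\<close> picks one of \<open>w\<close> and
    \<open>1 / w\<close>, so \<open>d\<close> takes infinitely many values.\<close>
  have "inj_on d {1<..}"
  proof (rule inj_onI)
    fix v w assume "v \<in> {1<..}" "w \<in> {1<..}" "d v = d w"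
    then have *: "v > 1" "w > 1" "v + 1 / v = w + 1 / w" by (simp_all add: d_def)
    then have "(v - w) * (v * w - 1) = 0" by (simp add: field_simps)
    moreover have "v * w > 1" using * by (simp add: less_1_mult)
    ultimately show "v = w" by simp
  qed
  moreover have "infinite ({1<..} :: puiseux set)" by (rule infinite_Ioi)
  ultimately have inf: "infinite (d ` {1<..})" by (simp add: finite_image_iff)
  have "R = 0" if "\<And>w. w > 1 \<Longrightarrow> poly R (d w) = 0" for R
  proof (rule ccontr)
    assume "R \<noteq> 0"
    then have "finite {z. poly R z = 0}" by (rule poly_roots_finite)
    moreover have "d ` {1<..} \<subseteq> {z. poly R z = 0}" using that by auto
    ultimately show False using inf finite_subset by blast
  qed
  then have "A = 0" "B = 0" using roots by blast+
  then show ?thesis unfolding ideal_gen_cubic by (auto simp: P sub_poly_0)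
qed

lemma real_radical_cubic: "real_radical (ideal_gen {cubic})"
  unfolding real_radical_def
proof (intro conjI set_eqI iffI)
  show "is_ideal (ideal_gen {cubic})" by (rule module.subspace_span[OF module_kpoly])
next
  fix P assume "P \<in> ideal_gen {cubic}"
  then obtain Q where "P = Q * cubic" by (auto simp: ideal_gen_cubic)
  then have "P ^ (2 * 1) + (\<Sum>G\<leftarrow>[]. G\<^sup>2) = (P * Q) * cubic"
    by (simp add: power2_eq_square algebra_simps)
  then show "P \<in> real_radical_of (ideal_gen {cubic})"
    unfolding real_radical_of_def ideal_gen_cubic by blast
next
  fix P assume "P \<in> real_radical_of (ideal_gen {cubic})"
  then obtain m Gs Q where Q: "P ^ (2 * m) + (\<Sum>G\<leftarrow>Gs. G\<^sup>2) = Q * cubic"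
    unfolding real_radical_of_def ideal_gen_cubic by blast
  show "P \<in> ideal_gen {cubic}"
  proof (rule ideal_gen_cubic_if_vanishing)
    fix w :: puiseux assume "w \<noteq> 0"
    then show "poly_eval P (cubic_param w) = 0"
      using poly_eval_eq_0_if_sum_of_squares[of P m Gs "cubic_param w"]
      by (simp add: Q poly_eval_mult poly_eval_cubic_param)
  qed
qed

section \<open>A point in every tropical hypersurface\<close>

text \<open>The initial form of \<open>P\<close> of weight \<open>\<mu>\<close> for \<open>|p| = (-1, -1)\<close>, evaluated at \<open>(a, b)\<close>.\<close>

definition init_eval :: "2 kpoly \<Rightarrow> rat \<Rightarrow> real \<Rightarrow> real \<Rightarrow> real" where
  "init_eval P \<mu> a b = (\<Sum>l\<in>Poly_Mapping.keys P.
     puiseux_coeff (Poly_Mapping.lookup P l)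
       (\<mu> + of_nat (Poly_Mapping.lookup l 1 + Poly_Mapping.lookup l 2)) *
     (a ^ Poly_Mapping.lookup l 1 * b ^ Poly_Mapping.lookup l 2))"

text \<open>The value of \<open>trop_weight\<close> at \<open>pole_point\<close>, kept rational so
  that it can serve as an exponent of a Puiseux series.\<close>

definition pole_weight :: "2 kpoly \<Rightarrow> (2 \<Rightarrow>\<^sub>0 nat) \<Rightarrow> rat" where
  "pole_weight P l = puiseux_val (Poly_Mapping.lookup P l)
     - of_nat (Poly_Mapping.lookup l 1 + Poly_Mapping.lookup l 2)"

lemma prod_UNIV_2: "prod f (UNIV :: 2 set) = f 1 * f 2"
  by (simp add: UNIV_2)

text \<open>At \<open>(a / t, b / t)\<close> a monomial of total degree \<open>n\<close> lowers
  exponents by \<open>n\<close>, so no term starts below \<mu>. Terms of weight above \<mu>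
  contribute 0 at \<mu>, their coefficient being read below its valuation.\<close>

lemma has_lead_poly_eval_pole:
  assumes "\<And>l. l \<in> Poly_Mapping.keys P \<Longrightarrow> \<mu> \<le> pole_weight P l"
  shows "has_lead (poly_eval P (vector [puiseux_pole a, puiseux_pole b])) \<mu> (init_eval P \<mu> a b)"
  unfolding poly_eval_def init_eval_def
proof (rule has_lead_sum)
  fix l assume l: "l \<in> Poly_Mapping.keys P"
  let ?i = "Poly_Mapping.lookup l 1" and ?j = "Poly_Mapping.lookup l 2" and ?c = "Poly_Mapping.lookup P l"
  have c: "?c \<noteq> 0" using l by (simp add: in_keys_iff)
  have "\<mu> + of_nat (?i + ?j) \<le> puiseux_val ?c" using assms[OF l] by (simp add: pole_weight_def)
  then have "has_lead ?c (\<mu> + of_nat (?i + ?j)) (puiseux_coeff ?c (\<mu> + of_nat (?i + ?j)))"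
    using has_lead_val[OF c] by (auto simp: has_lead_def)
  from has_lead_mult[OF this has_lead_mult[OF has_lead_power[OF has_lead_pole[of a], of ?i]
        has_lead_power[OF has_lead_pole[of b], of ?j]]]
  show "has_lead (?c * (\<Prod>k\<in>UNIV. (vector [puiseux_pole a, puiseux_pole b] $ k) ^ Poly_Mapping.lookup l k))
      \<mu> (puiseux_coeff ?c (\<mu> + of_nat (?i + ?j)) * (a ^ ?i * b ^ ?j))"
    by (simp add: prod_UNIV_2)
qed

text \<open>The substitution \<open>b = a ^ N\<close> with \<open>N\<close> large separates the monomials.\<close>

lemma real_monomial_sum_nonzero:
  fixes c :: "(2 \<Rightarrow>\<^sub>0 nat) \<Rightarrow> real"
  assumes "finite S" "l0 \<in> S" "c l0 \<noteq> 0"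
  obtains a b where "a > 0" "b > 0" "a \<noteq> b"
    "(\<Sum>l\<in>S. c l * (a ^ Poly_Mapping.lookup l 1 * b ^ Poly_Mapping.lookup l 2)) \<noteq> 0"
proof -
  \<comment> \<open>One \<open>Suc\<close> puts \<open>N\<close> above all first exponents, so that
    \<open>e\<close> is injective on \<open>S\<close> by division with remainder; the other gives
    \<open>N >= 2\<close>, hence \<open>a\<close> differs from \<open>a ^ N\<close>.\<close>
  define N where "N = Suc (Suc (Max ((\<lambda>l. Poly_Mapping.lookup l 1) ` S)))"
  have N: "Poly_Mapping.lookup l 1 < N" if "l \<in> S" for l
    using Max_ge[of "(\<lambda>l. Poly_Mapping.lookup l 1) ` S" "Poly_Mapping.lookup l 1"] that assms(1)
    by (simp add: N_def del: Max_ge)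
  have "N > 0" by (simp add: N_def)
  define e where "e l = Poly_Mapping.lookup l 1 + N * Poly_Mapping.lookup l 2" for l :: "2 \<Rightarrow>\<^sub>0 nat"
  have inj: "l = l'" if "l \<in> S" "l' \<in> S" "e l = e l'" for l l'
  proof (rule poly_mapping_eqI)
    have "e l mod N = e l' mod N" "e l div N = e l' div N" using that by simp_all
    then have "Poly_Mapping.lookup l 1 = Poly_Mapping.lookup l' 1"
      "Poly_Mapping.lookup l 2 = Poly_Mapping.lookup l' 2"
      using N that \<open>N > 0\<close> by (auto simp: e_def)
    then show "Poly_Mapping.lookup l k = Poly_Mapping.lookup l' k" for k
      using exhaust_2[of k] by auto
  qed
  define p where "p = (\<Sum>l\<in>S. monom (c l) (e l))"
  have "coeff p (e l0) = (\<Sum>l\<in>S. if l = l0 then c l else 0)"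
    unfolding p_def coeff_sum by (rule sum.cong) (use inj assms in auto)
  then have "p \<noteq> 0" using assms by auto
  then have "finite {a. poly p a = 0}" by (rule poly_roots_finite)
  moreover have "infinite ({1<..} :: real set)" by (rule infinite_Ioi)
  ultimately have "\<not> {1<..} \<subseteq> {a. poly p a = 0}" using finite_subset by blast
  then obtain a where a: "a > 1" "poly p a \<noteq> 0" by auto
  show thesis
  proof (rule that[of a "a ^ N"])
    show "a \<noteq> a ^ N" using a power_strict_increasing[of 1 N a] by (simp add: N_def)
    show "(\<Sum>l\<in>S. c l * (a ^ Poly_Mapping.lookup l 1 * (a ^ N) ^ Poly_Mapping.lookup l 2)) \<noteq> 0"
      using a by (simp add: p_def poly_sum poly_monom e_def power_add power_mult)
  qed (use a in simp_all)
qed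

lemma min_pole_weight:
  assumes "P \<noteq> 0"
  obtains l where "l \<in> Poly_Mapping.keys P"
    "\<And>k. k \<in> Poly_Mapping.keys P \<Longrightarrow> pole_weight P l \<le> pole_weight P k"
proof -
  have "finite (Poly_Mapping.keys P)" "Poly_Mapping.keys P \<noteq> {}" using assms by auto
  then show thesis
    using that ex_is_arg_min_if_finite[of "Poly_Mapping.keys P" "pole_weight P"]
    by (auto simp: is_arg_min_linorder)
qed

lemma init_coeff_nonzero:
  assumes "l \<in> Poly_Mapping.keys P"
  shows "puiseux_coeff (Poly_Mapping.lookup P l)
    (pole_weight P l + of_nat (Poly_Mapping.lookup l 1 + Poly_Mapping.lookup l 2)) \<noteq> 0"
  using assms puiseux_coeff_val_nonzero[of "Poly_Mapping.lookup P l"]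
  by (simp add: pole_weight_def in_keys_iff)

text \<open>Compares orders at two points, with \<open>M\<close> the minimal weight of the cofactor
  \<open>G\<close>. At \<open>(1 / t, 1 / t)\<close> the cubic part vanishes, so \<open>H\<close>
  has order at least \<open>M - 2\<close>; a nonzero value of the initial form would make that order
  at most \<mu>. At a generic \<open>(a / t, b / t)\<close> the order is exactly
  \<open>M - 3\<close>, which forces \<mu> \<le> \<open>M - 3\<close>, a contradiction.\<close>

lemma init_eval_cubic_multiple:
  fixes H :: "2 kpoly"
  assumes H: "H \<in> ideal_gen {cubic}" "H \<noteq> 0"
    and lH: "\<And>k. k \<in> Poly_Mapping.keys H \<Longrightarrow> \<mu> \<le> pole_weight H k"
  shows "init_eval H \<mu> 1 1 = 0"
proof (rule ccontr)
  assume nz: "init_eval H \<mu> 1 1 \<noteq> 0"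
  obtain G where G: "H = G * cubic" using H by (auto simp: ideal_gen_cubic)
  then have "G \<noteq> 0" using H by auto
  then obtain l where l: "l \<in> Poly_Mapping.keys G"
    and min: "\<And>k. k \<in> Poly_Mapping.keys G \<Longrightarrow> pole_weight G l \<le> pole_weight G k"
    by (metis min_pole_weight)
  define M where "M = pole_weight G l"
  have leadG: "has_lead (poly_eval G (vector [puiseux_pole a, puiseux_pole b])) M (init_eval G M a b)" for a b
    using has_lead_poly_eval_pole[of G M a b] min by (simp add: M_def)
  have leadH: "has_lead (poly_eval H (vector [puiseux_pole a, puiseux_pole b])) \<mu> (init_eval H \<mu> a b)" for a b
    using has_lead_poly_eval_pole[of H \<mu> a b] lH by simp
  have two: "has_lead 2 0 2" using has_lead_add[OF has_lead_one has_lead_one] by simp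
  \<comment> \<open>The constant 2 has order 0, so it does not affect the coefficient at -1.\<close>
  have two': "has_lead 2 (-1) 0" by (rule has_lead_weaken[OF two]) simp
  have s: "has_lead (puiseux_pole a + puiseux_pole b - 2) (-1) (a + b)" for a b
    using has_lead_diff[OF has_lead_add[OF has_lead_pole[of a] has_lead_pole[of b]] two'] by simp
  have s2: "has_lead (2 * (puiseux_pole a + puiseux_pole b - 2)\<^sup>2) (-2) (2 * (a + b)\<^sup>2)" for a b
    using has_lead_mult[OF two has_lead_power[OF s[of a b], of 2]] by simp
  have "poly_eval cubic (vector [puiseux_pole 1, puiseux_pole 1]) =
      2 * (puiseux_pole 1 + puiseux_pole 1 - 2)\<^sup>2"
    by (simp add: poly_eval_cubic)
  then have "has_lead (poly_eval H (vector [puiseux_pole 1, puiseux_pole 1])) (M + (-2))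
      (init_eval G M 1 1 * (2 * (1 + 1)\<^sup>2))"
    unfolding G poly_eval_mult by (simp only: has_lead_mult[OF leadG s2])
  then have 1: "M - 2 \<le> \<mu>"
    using has_lead_unique_le[OF leadH nz] by simp
  \<comment> \<open>Positive and distinct \<open>a\<close>, \<open>b\<close> keep
    \<open>(a + b) * (a - b)^2\<close> nonzero.\<close>
  obtain a b where ab: "a > 0" "b > 0" "a \<noteq> b" "init_eval G M a b \<noteq> 0"
    unfolding init_eval_def M_def
    by (rule real_monomial_sum_nonzero[OF finite_keys l, where c = "\<lambda>k. puiseux_coeff (Poly_Mapping.lookup G k)
       (pole_weight G l + of_nat (Poly_Mapping.lookup k 1 + Poly_Mapping.lookup k 2))"])
      (use init_coeff_nonzero[OF l] in blast)+
  have "has_lead (poly_eval cubic (vector [puiseux_pole a, puiseux_pole b])) (-3)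
      ((a + b) * (a - b)\<^sup>2 + 0)"
    unfolding poly_eval_cubic vector_2
  proof (rule has_lead_add)
    show "has_lead ((puiseux_pole a + puiseux_pole b) * (puiseux_pole a - puiseux_pole b)\<^sup>2) (-3)
        ((a + b) * (a - b)\<^sup>2)"
      using has_lead_mult[OF has_lead_add[OF has_lead_pole[of a] has_lead_pole[of b]]
          has_lead_power[OF has_lead_diff[OF has_lead_pole[of a] has_lead_pole[of b]], of 2]]
      by simp
    show "has_lead (2 * (puiseux_pole a + puiseux_pole b - 2)\<^sup>2) (-3) 0"
      by (rule has_lead_weaken[OF s2]) simp
  qed
  from has_lead_mult[OF leadG this]
  have "has_lead (poly_eval H (vector [puiseux_pole a, puiseux_pole b])) (M + (-3))
      (init_eval G M a b * ((a + b) * (a - b)\<^sup>2 + 0))"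
    by (simp only: G poly_eval_mult)
  moreover have "init_eval G M a b * ((a + b) * (a - b)\<^sup>2 + 0) \<noteq> 0" using ab by simp
  ultimately have "\<mu> \<le> M + (-3)" using leadH by (rule has_lead_unique_le)
  then show False using 1 by simp
qed

definition pole_point :: "(int \<times> real) ^ 2" where
  "pole_point = (\<chi> k. (1, -1))"

lemma pole_point_TR: "pole_point \<in> TR_space"
  by (simp add: pole_point_def TR_space_def TR_def)

lemma trop_weight_pole_point: "trop_weight P pole_point l = real_of_rat (pole_weight P l)"
  by (simp add: trop_weight_def pole_weight_def pole_point_def sum_2 of_rat_diff of_rat_add)

lemma trop_sign_pole_point:
  "trop_sign P pole_point l = (if Poly_Mapping.lookup P l > 0 then 1 else -1)"
  by (simp add: trop_sign_def pole_point_def trop_def)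

lemma sum_eq_0_both_signs:
  fixes f :: "'a \<Rightarrow> 'b::linordered_ab_group_add"
  assumes "finite A" "sum f A = 0" "a \<in> A" "f a \<noteq> 0"
  obtains i j where "i \<in> A" "j \<in> A" "f i > 0" "f j < 0"
proof -
  have "\<exists>i\<in>A. f i > 0"
    using sum_nonneg_eq_0_iff[of A "\<lambda>i. - f i"] assms by (force simp: sum_negf not_less[symmetric])
  moreover have "\<exists>j\<in>A. f j < 0"
    using sum_nonneg_eq_0_iff[of A f] assms by (force simp: not_less[symmetric])
  ultimately show thesis using that by blast
qed

text \<open>The values \<open>f k\<close> sum to 0 without all being 0, so both signs occur. A
  nonzero \<open>f k\<close> forces \<open>k\<close> to have minimal weight, and \<open>f k\<close>
  is then the leading coefficient that determines the sign of the term.\<close>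

lemma pole_point_in_hypersurface:
  fixes H :: "2 kpoly"
  assumes H: "H \<in> ideal_gen {cubic}" "H \<noteq> 0"
  shows "pole_point \<in> real_trop_hypersurface H"
proof -
  obtain l where l: "l \<in> Poly_Mapping.keys H"
    and min: "\<And>k. k \<in> Poly_Mapping.keys H \<Longrightarrow> pole_weight H l \<le> pole_weight H k"
    using min_pole_weight[OF H(2)] by metis
  define f where "f k = puiseux_coeff (Poly_Mapping.lookup H k)
    (pole_weight H l + of_nat (Poly_Mapping.lookup k 1 + Poly_Mapping.lookup k 2))" for k
  have "init_eval H (pole_weight H l) 1 1 = 0"
    using H min by (rule init_eval_cubic_multiple)
  then have "sum f (Poly_Mapping.keys H) = 0" by (simp add: init_eval_def f_def)
  moreover have "f l \<noteq> 0" unfolding f_def by (rule init_coeff_nonzero[OF l])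
  ultimately obtain i j where ij: "i \<in> Poly_Mapping.keys H" "j \<in> Poly_Mapping.keys H" "f i > 0" "f j < 0"
    using sum_eq_0_both_signs[OF finite_keys _ l] by metis
  have w: "pole_weight H k = pole_weight H l" if "k \<in> Poly_Mapping.keys H" "f k \<noteq> 0" for k
  proof -
    have "Poly_Mapping.lookup H k \<noteq> 0" using that(1) by (simp add: in_keys_iff)
    \<comment> \<open>A nonzero coefficient at this exponent bounds the valuation from above;
      minimality of \<open>l\<close> gives the other inequality.\<close>
    then have "puiseux_val (Poly_Mapping.lookup H k)
        \<le> pole_weight H l + of_nat (Poly_Mapping.lookup k 1 + Poly_Mapping.lookup k 2)"
      using has_lead_val[of "Poly_Mapping.lookup H k"] that(2)
      by (auto simp: has_lead_def f_def not_less[symmetric])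
    then show ?thesis using min[OF that(1)] by (simp add: pole_weight_def)
  qed
  have pos: "Poly_Mapping.lookup H k > 0 \<longleftrightarrow> f k > 0" if "k \<in> Poly_Mapping.keys H" "f k \<noteq> 0" for k
    unfolding puiseux_pos_iff f_def w[OF that, symmetric] by (simp add: pole_weight_def)
  have m: "trop_weight H pole_point k = Min (trop_weight H pole_point ` Poly_Mapping.keys H)"
    if "k \<in> Poly_Mapping.keys H" "f k \<noteq> 0" for k
    by (rule Min_eqI[symmetric])
      (use that min w[OF that] in \<open>auto simp: trop_weight_pole_point of_rat_less_eq image_iff intro!: bexI[of _ k]\<close>)
  have "i \<noteq> j" using ij by auto
  moreover have "trop_sign H pole_point i = 1" "trop_sign H pole_point j = -1"
    using ij pos[of i] pos[of j] by (simp_all add: trop_sign_pole_point)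
  moreover have "f i \<noteq> 0" "f j \<noteq> 0" using ij by simp_all
  ultimately show ?thesis
    unfolding real_trop_hypersurface_def using ij m pole_point_TR by blast
qed

section \<open>The point is not in the tropical variety\<close>

text \<open>For positive coordinates both summands of the cubic are nonnegative, so both vanish: the
  coordinates are equal and sum to 2.\<close>

lemma cubic_pos_zero:
  assumes "poly_eval cubic z = 0" "z $ 1 > 0" "z $ 2 > 0"
  shows "z $ 1 = 1"
proof -
  have s: "z $ 1 + z $ 2 > 0" using assms by simp
  have 1: "(z $ 1 + z $ 2) * (z $ 1 - z $ 2)\<^sup>2 \<ge> 0" using s by simp
  have 2: "2 * (z $ 1 + z $ 2 - 2)\<^sup>2 \<ge> 0" by simp
  have "(z $ 1 + z $ 2) * (z $ 1 - z $ 2)\<^sup>2 = 0 \<and> 2 * (z $ 1 + z $ 2 - 2)\<^sup>2 = 0"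
    using assms(1) add_nonneg_eq_0_iff[OF 1 2] unfolding poly_eval_cubic by blast
  then have "z $ 1 = z $ 2" "z $ 1 + z $ 2 = 2" using s by auto
  then show ?thesis by simp
qed

lemma pole_point_not_in_variety: "pole_point \<notin> trop_variety (ideal_gen {cubic})"
proof
  assume p: "pole_point \<in> trop_variety (ideal_gen {cubic})"
  \<comment> \<open>Membership in a closure is refuted by a whole neighbourhood: points of
    \<open>U\<close> come from positive coordinates of negative valuation, while the only positive
    zero has valuation 0.\<close>
  define U where "U = {q :: (int \<times> real) ^ 2. q $ 1 \<in> {1} \<times> {..<0} \<and> q $ 2 \<in> {1} \<times> {..<0}}"
  have o: "open ({1::int} \<times> {..<0::real})" by (intro open_Times open_discrete open_lessThan)
  have "U = (\<lambda>q. q $ 1) -` ({1} \<times> {..<0}) \<inter> (\<lambda>q. q $ 2) -` ({1} \<times> {..<0})"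
    by (auto simp: U_def)
  then have "open U" by (simp only:) (intro open_Int open_vimage_vec_nth o)
  then have "openin (top_of_set TR_space) (TR_space \<inter> U)" by auto
  moreover have "pole_point \<in> TR_space \<inter> U"
    using pole_point_TR by (simp add: U_def pole_point_def)
  ultimately obtain q where "q \<in> (\<lambda>x. \<chi> k. trop (x $ k)) `
      (zero_set (ideal_gen {cubic}) \<inter> {x. \<forall>k. x $ k \<noteq> 0})" "q \<in> TR_space \<inter> U"
    using p unfolding trop_variety_def in_closure_of by meson
  then obtain z where z: "z \<in> zero_set (ideal_gen {cubic})" "(\<chi> k. trop (z $ k)) \<in> U"
    by blast
  have "cubic \<in> ideal_gen {cubic}" unfolding ideal_gen_cubic by (metis mult_1)
  then have "poly_eval cubic z = 0" using z(1) by (auto simp: zero_set_def)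
  moreover have "z $ 1 > 0" "z $ 2 > 0" "puiseux_val (z $ 1) < 0"
    using z(2) by (auto simp: U_def trop_def split: if_splits)
  ultimately have "z $ 1 = 1" by (intro cubic_pos_zero)
  then show False using \<open>puiseux_val (z $ 1) < 0\<close> by (simp add: puiseux_val_one)
qed

lemma no_real_tropical_basis_cubic: "\<not> real_tropical_basis B (ideal_gen {cubic})"
proof
  assume B: "real_tropical_basis B (ideal_gen {cubic})"
  have "pole_point \<in> real_trop_hypersurface H" if "H \<in> B" for H
  proof (rule pole_point_in_hypersurface)
    show "H \<in> ideal_gen {cubic}"
      using B module.span_base[OF module_kpoly that] by (simp add: real_tropical_basis_def)
    show "H \<noteq> 0" using B that by (auto simp: real_tropical_basis_def)
  qed
  then show False
    using B pole_point_TR pole_point_not_in_variety by (auto simp: real_tropical_basis_def)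
qed

theorem mainTheorem4:
  fixes x y F :: "2 kpoly"
  defines "x \<equiv> Var 1" and "y \<equiv> Var 2"
  defines "F \<equiv> x^3 + y^3 - x^2 * y - x * y^2 + 2 * x^2 + 2 * y^2 + 4 * x * y - 8 * x - 8 * y + 8"
  shows "real_radical (ideal_gen {F}) \<and>
         (\<nexists>B. real_tropical_basis B (ideal_gen {F})) \<and>
         (\<exists>I :: 2 kpoly set. real_radical I \<and> (\<nexists>B. real_tropical_basis B I))"
proof -
  have "F = cubic"
    by (simp add: F_def x_def y_def cubic_def power2_eq_square power3_eq_cube algebra_simps)
  then show ?thesis using real_radical_cubic no_real_tropical_basis_cubic by blast
qed

end
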